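(* The generating function $$\mathrm{DSV}(x,y,p,d)=\sum_{n,k\geq 0}\ \sum_{\pi\in C_{n,k}}x^n y^k p^{\mathrm{sv}(\pi)}d^{\mathrm{dsv}(\pi)}$$ for the number of compositions of $n$ with exactly $k$ parts according to the number of symmetric valleys and the sum of the depths of symmetric valleys is given by $$\mathrm{DSV}(x,y,p,d)=\frac{1}{1-\sum_{a\geq1}\dfrac{x^ay}{1-y^2x^{a+1}\left(\dfrac{p\,(x^{a-1}-d^{a-1})}{\frac{x}{d}-1}-\dfrac{x^{a-1}-1}{x-1}\right)}}.$$
   Context: A composition of a positive integer $n$ with $k$ parts is a sequence $\pi=\pi_1\pi_2\cdots\pi_k$ of positive integers with $\sum_{i=1}^k\pi_i=n$. $C_{n,k}$ denotes the set of all compositions of $n$ with exactly $k$ parts, with the conventions $|C_{0,0}|=1$ (the empty composition), $|C_{0,k}|=0$ for $k\ge 1$. A symmetric valley of $\pi$ is a triple of consecutive parts $\pi_i\pi_{i+1}\pi_{i+2}$ ($1\le i\le k-2$) with $\pi_i>\pi_{i+1}$ and $\pi_i=\pi_{i+2}$; its depth is $\pi_i-\pi_{i+1}$. $\mathrm{sv}(\pi)$ is the number of symmetric valleys of $\pi$ (number of such indices $i$), and $\mathrm{dsv}(\pi)$ is the sum of the depths of all symmetric valleys of $\pi$. The identity is one of formal power series in $x$ with coefficients polynomial in $y,p,d$ (the quotients $\frac{x^{a-1}-d^{a-1}}{x/d-1}$ and $\frac{x^{a-1}-1}{x-1}$ are polynomials in $x,d$). *)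

theory Defs
  imports "HOL-Computational_Algebra.Computational_Algebra"
begin

section \<open>Compositions and symmetric valleys\<close>

definition compositions :: "nat \<Rightarrow> nat \<Rightarrow> nat list set" where
  "compositions n k = {w. length w = k \<and> sum_list w = n \<and> (\<forall>a\<in>set w. 0 < a)}"

text \<open>Positions are counted from 0, as usual for lists.\<close>

definition sym_valleys :: "nat list \<Rightarrow> nat set" where
  "sym_valleys w = {i. i + 2 < length w \<and> w ! i > w ! (i + 1) \<and> w ! i = w ! (i + 2)}"

definition sv :: "nat list \<Rightarrow> nat" where
  "sv w = card (sym_valleys w)"

text \<open>The subtraction on naturals does not truncate at the indices summed over.\<close>

definition dsv :: "nat list \<Rightarrow> nat" where
  "dsv w = (\<Sum>i\<in>sym_valleys w. w ! i - w ! (i + 1))"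

lemma length_le_sum_list:
  fixes w :: "nat list"
  assumes "\<forall>a\<in>set w. 0 < a"
  shows "length w \<le> sum_list w"
  using assms by (induction w) auto

lemma compositions_empty: "n < k \<Longrightarrow> compositions n k = {}"
  using length_le_sum_list by (fastforce simp: compositions_def)

lemma finite_compositions: "finite (compositions n k)"
proof (rule finite_subset)
  show "compositions n k \<subseteq> {w. set w \<subseteq> {..n} \<and> length w = k}"
    using member_le_sum_list by (auto simp: compositions_def)
  show "finite {w. set w \<subseteq> {..n} \<and> length w = k}"
    by (rule finite_lists_length_eq) simp
qed

lemma compositions_0: "compositions 0 k = (if k = 0 then {[]} else {})"
  using compositions_empty[of 0 k] by (cases "k = 0") (auto simp: compositions_def)

lemma finite_sym_valleys: "finite (sym_valleys w)"
  by (rule finite_subset[of _ "{..<length w}"]) (auto simp: sym_valleys_def)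


section \<open>The generating function\<close>

text \<open>The power series variable is \<open>fps_X\<close>. By \<open>compositions_empty\<close> nothing
  is lost by bounding the number of parts by \<open>n\<close> in the coefficient of the \<open>n\<close>-th power.\<close>

definition DSV :: "'a::comm_semiring_1 \<Rightarrow> 'a \<Rightarrow> 'a \<Rightarrow> 'a fps" where
  "DSV y p d =
     Abs_fps (\<lambda>n. \<Sum>k\<le>n. \<Sum>w\<in>compositions n k. y ^ k * p ^ sv w * d ^ dsv w)"

text \<open>
  The coefficients are polynomials over the integers in the three indeterminates
  \<open>y\<close>, \<open>p\<close>, \<open>d\<close>. Since \<open>d\<close> is inverted in the closed form, they are regarded as
  elements of the field of fractions of the polynomial ring.
\<close>

type_synonym coeff_field = "int poly poly poly fract"

definition var_y :: coeff_field where "var_y = to_fract [:0, 1:]"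
definition var_p :: coeff_field where "var_p = to_fract [:[:0, 1:]:]"
definition var_d :: coeff_field where "var_d = to_fract [:[:[:0, 1:]:]:]"

text \<open>
  If \<open>d \<noteq> 0\<close>, every divisor below is a power series with nonzero constant
  term, so that the divisions are multiplications by inverses of units.
\<close>

definition dsv_term :: "'a::field \<Rightarrow> 'a \<Rightarrow> 'a \<Rightarrow> nat \<Rightarrow> 'a fps" where
  "dsv_term y p d a =
     fps_X ^ a * fps_const y /
       (1 - fps_const y ^ 2 * fps_X ^ (a + 1) *
          (fps_const p * (fps_X ^ (a - 1) - fps_const d ^ (a - 1)) / (fps_X / fps_const d - 1)
           - (fps_X ^ (a - 1) - 1) / (fps_X - 1)))"

end

theory Submission
  imports Defs "HOL-Library.Disjoint_Sets"
begin

text \<open>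
  Let \<open>D\<close> be the generating function of all compositions and \<open>F\<^sub>a\<close> that of the
  compositions with first part \<open>a\<close>. Removing the first part \<open>a\<close> would give
  \<open>F\<^sub>a = x\<^sup>a y D\<close> if no valley were lost. A valley is lost exactly when the composition
  begins with \<open>a b a\<close> for some \<open>b < a\<close>, and then the weight must be corrected by the factor
  \<open>p d\<^bsup>a-b\<^esup>\<close>. The remaining composition begins with \<open>b a\<close>; as \<open>b < a\<close>, no valley starts
  at \<open>b\<close>, so the compositions of this shape have generating function \<open>x\<^sup>b y F\<^sub>a\<close>: the
  \<^emph>\<open>same\<close> series \<open>F\<^sub>a\<close> returns. Hence \<open>F\<^sub>a\<close> satisfies a linear equation of its own,
  \<open>F\<^sub>a = x\<^sup>a y (D + y F\<^sub>a \<Sum>\<^bsub>0<b<a\<^esub> x\<^sup>b (p d\<^bsup>a-b\<^esup> - 1))\<close>,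
  without reference to the other first parts (\<open>gf_first_recurrence\<close>).

  Summing the two finite geometric progressions (\<open>dsv_term_Suc\<close>), its solution is
  \<open>F\<^sub>a = t\<^sub>a D\<close>, where \<open>t\<^sub>a\<close> is the summand of the closed form
  (\<open>dsv_term_mult_DSV\<close>). A composition is empty or has a first part, so
  \<open>D = 1 + \<Sum>\<^sub>a F\<^sub>a = 1 + D \<Sum>\<^sub>a t\<^sub>a\<close>, which is the claim. The infinite sum converges because
  a composition of \<open>n\<close> has first part at most \<open>n\<close>, so that each coefficient of the partial
  sums is eventually constant (\<open>DSV_nth_eq_sum_gf_first\<close>).

  The argument works for values \<open>y\<close>, \<open>p\<close>, \<open>d\<close> in any field, as long as \<open>d \<noteq> 0\<close>.
\<close>

section \<open>Prepending a part to a composition\<close>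

definition weight :: "'a::comm_semiring_1 \<Rightarrow> 'a \<Rightarrow> 'a \<Rightarrow> nat list \<Rightarrow> 'a" where
  "weight y p d w = y ^ length w * p ^ sv w * d ^ dsv w"

text \<open>
  A new first part only adds the triple at position 0; all other valleys are shifted by one and
  keep their depths. So the weight picks up a factor that depends only on whether that triple
  is a valley.
\<close>

lemma sym_valleys_Cons:
  assumes "\<nexists>b u. w = b # a # u \<and> b < a"
  shows "sym_valleys (a # w) = Suc ` sym_valleys w"
proof -
  have "i \<in> sym_valleys (a # w) \<longleftrightarrow> i \<in> Suc ` sym_valleys w" for i
  proof (cases i)
    case 0
    have "0 \<notin> sym_valleys (a # w)"
    proof
      assume "0 \<in> sym_valleys (a # w)"
      then have "2 \<le> length w" "w ! 0 < a" "w ! 1 = a"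
        by (auto simp: sym_valleys_def)
      moreover from \<open>2 \<le> length w\<close> obtain b c u where "w = b # c # u"
        by (auto simp: numeral_2_eq_2 Suc_le_length_iff)
      ultimately show False
        using assms by auto
    qed
    with 0 show ?thesis
      by auto
  next
    case (Suc j)
    then show ?thesis
      by (auto simp: sym_valleys_def)
  qed
  then show ?thesis
    by blast
qed

lemma sym_valleys_Cons_valley:
  assumes "b < a"
  shows "sym_valleys (a # b # a # u) = insert 0 (Suc ` sym_valleys (b # a # u))"
proof -
  have "i \<in> sym_valleys (a # b # a # u) \<longleftrightarrow> i \<in> insert 0 (Suc ` sym_valleys (b # a # u))" for i
    using assms by (cases i) (auto simp: sym_valleys_def)
  then show ?thesis
    by blast
qed

lemma weight_Cons:
  assumes "\<nexists>b u. w = b # a # u \<and> b < a"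
  shows "weight y p d (a # w) = y * weight y p d w"
  unfolding weight_def sv_def dsv_def sym_valleys_Cons[OF assms]
  by (simp add: card_image sum.reindex mult.assoc)

lemma weight_Cons_valley:
  assumes "b < a"
  shows "weight y p d (a # b # a # u) = y * (p * d ^ (a - b)) * weight y p d (b # a # u)"
  unfolding weight_def sv_def dsv_def sym_valleys_Cons_valley[OF assms]
  by (simp add: card_image sum.reindex finite_sym_valleys power_add mult_ac)


section \<open>Generating functions of sets of compositions\<close>

text \<open>
  Sets of arbitrary lists are allowed and only their members without the entry 0 are counted,
  so that sets like \<open>UNIV\<close>, \<open>range (Cons a)\<close> and complements can be used without mentioning
  positivity. Grading by the sum alone suffices since the number of parts is recorded in
  the exponent of \<open>y\<close>.
\<close>

definition gf :: "'a::comm_semiring_1 \<Rightarrow> 'a \<Rightarrow> 'a \<Rightarrow> nat list set \<Rightarrow> 'a fps" where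
  "gf y p d S = Abs_fps (\<lambda>n. \<Sum>w\<in>{w \<in> S. sum_list w = n \<and> 0 \<notin> set w}. weight y p d w)"

lemma comps_of_sum:
  "{w. sum_list w = n \<and> 0 \<notin> set w} = (\<Union>k\<le>n. compositions n k)"
proof -
  have "0 \<notin> set w \<longleftrightarrow> (\<forall>a\<in>set w. 0 < a)" for w :: "nat list"
    by (metis gr0I less_numeral_extra(3))
  then show ?thesis
    using length_le_sum_list by (auto simp: compositions_def)
qed

lemma finite_comps_of_sum: "finite {w \<in> S. sum_list w = (n::nat) \<and> 0 \<notin> set w}"
proof (rule finite_subset)
  show "{w \<in> S. sum_list w = n \<and> 0 \<notin> set w} \<subseteq> (\<Union>k\<le>n. compositions n k)"
    by (auto simp flip: comps_of_sum)
qed (simp add: finite_compositions)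

lemma DSV_eq_gf: "DSV y p d = gf y p d UNIV"
proof (rule fps_ext)
  fix n
  have "fps_nth (DSV y p d) n = (\<Sum>w\<in>(\<Union>k\<le>n. compositions n k). weight y p d w)"
    by (subst sum.UNION_disjoint)
       (simp_all add: DSV_def weight_def finite_compositions, auto simp: compositions_def)
  also have "\<dots> = fps_nth (gf y p d UNIV) n"
    by (simp add: gf_def comps_of_sum)
  finally show "fps_nth (DSV y p d) n = fps_nth (gf y p d UNIV) n" .
qed

lemma gf_UN:
  assumes "finite I" and "disjoint_family_on S I"
  shows "gf y p d (\<Union>i\<in>I. S i) = (\<Sum>i\<in>I. gf y p d (S i))"
proof (rule fps_ext)
  fix n
  have "{w \<in> \<Union>(S ` I). sum_list w = n \<and> 0 \<notin> set w}
      = (\<Union>i\<in>I. {w \<in> S i. sum_list w = n \<and> 0 \<notin> set w})"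
    by auto
  then have "fps_nth (gf y p d (\<Union>i\<in>I. S i)) n
      = (\<Sum>w\<in>(\<Union>i\<in>I. {w \<in> S i. sum_list w = n \<and> 0 \<notin> set w}). weight y p d w)"
    by (simp add: gf_def)
  also have "\<dots> = (\<Sum>i\<in>I. fps_nth (gf y p d (S i)) n)"
    using assms
    by (subst sum.UNION_disjoint)
       (auto simp: gf_def disjoint_family_on_def finite_comps_of_sum)
  finally show "fps_nth (gf y p d (\<Union>i\<in>I. S i)) n = fps_nth (\<Sum>i\<in>I. gf y p d (S i)) n"
    by (simp add: fps_sum_nth)
qed

lemma gf_Un:
  assumes "S \<inter> T = {}"
  shows "gf y p d (S \<union> T) = gf y p d S + gf y p d T"
proof -
  have "gf y p d (\<Union>i\<in>UNIV. if i then S else T) = (\<Sum>i\<in>UNIV. gf y p d (if i then S else T))"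
    using assms by (intro gf_UN) (auto simp: disjoint_family_on_def)
  moreover have "(\<Union>i\<in>UNIV. if i then S else T) = S \<union> T"
    by (auto split: if_splits)
  ultimately show ?thesis
    by (simp add: UNIV_bool add.commute)
qed

lemma gf_Cons_image:
  assumes "0 < a"
    and "\<And>w. w \<in> S \<Longrightarrow> 0 \<notin> set w \<Longrightarrow> weight y p d (a # w) = c * weight y p d w"
  shows "gf y p d (Cons a ` S) = fps_X ^ a * fps_const c * gf y p d S"
proof (rule fps_ext)
  fix n
  have *: "{w \<in> Cons a ` S. sum_list w = n \<and> 0 \<notin> set w}
      = (if n < a then {} else Cons a ` {w \<in> S. sum_list w = n - a \<and> 0 \<notin> set w})"
    using assms(1) by auto
  show "fps_nth (gf y p d (Cons a ` S)) n
      = fps_nth (fps_X ^ a * fps_const c * gf y p d S) n"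
    using assms(2)
    by (auto simp: gf_def * fps_X_power_mult_nth mult.assoc sum.reindex sum_distrib_left
        intro!: sum.cong)
qed


section \<open>Compositions with a given first part\<close>

abbreviation gf_first :: "'a::comm_semiring_1 \<Rightarrow> 'a \<Rightarrow> 'a \<Rightarrow> nat \<Rightarrow> 'a fps" where
  "gf_first y p d a \<equiv> gf y p d (range (Cons a))"

text \<open>
  The set \<open>V i\<close> below consists of the lists that begin with \<open>b a\<close>, where \<open>b = Suc i\<close> and
  \<open>a = Suc m\<close>: after a first part \<open>a\<close> these are the ones that create a valley, of depth
  \<open>a - b = m - i\<close>. The factor \<open>p * d ^ (m - i) - 1\<close> replaces the ordinary contribution of
  such a list by the one with the valley counted.
\<close>

lemma gf_first_recurrence:
  fixes y p d :: "'a::comm_ring_1"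
  defines "T \<equiv> \<lambda>m. \<Sum>i<m. fps_X ^ i * fps_const (p * d ^ (m - i) - 1)"
  shows "gf_first y p d (Suc m) = fps_X ^ Suc m * fps_const y *
    (DSV y p d + fps_const y * fps_X * T m * gf_first y p d (Suc m))"
proof -
  define F where "F = gf_first y p d (Suc m)"
  define V where "V = (\<lambda>i. Cons (Suc i) ` range (Cons (Suc m)))"
  define N where "N = - (\<Union>i<m. V i)"
  have disj: "disjoint_family_on V {..<m}"
    by (auto simp: V_def disjoint_family_on_def)
  \<comment> \<open>A smaller first part followed by \<open>Suc m\<close> opens no valley.\<close>
  have gf_V: "gf y p d (V i) = fps_X ^ Suc i * fps_const y * F" if "i < m" for i
    unfolding V_def F_def using that by (intro gf_Cons_image weight_Cons) auto
  have gf_Cons_V: "gf y p d (Cons (Suc m) ` V i)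
      = fps_X ^ Suc m * fps_const (y * (p * d ^ (m - i))) * gf y p d (V i)" if "i < m" for i
    using that
    by (intro gf_Cons_image) (auto simp: V_def weight_Cons_valley)
  have gf_Cons_N: "gf y p d (Cons (Suc m) ` N) = fps_X ^ Suc m * fps_const y * gf y p d N"
  proof (rule gf_Cons_image)
    \<comment> \<open>\<open>V\<close> misses the middle part \<open>b = 0\<close>, which does not occur in compositions.\<close>
    fix w assume w: "w \<in> N" "0 \<notin> set w"
    have "\<nexists>b u. w = b # Suc m # u \<and> b < Suc m"
    proof safe
      fix b u assume bu: "w = b # Suc m # u" "b < Suc m"
      with w(2) obtain i where "b = Suc i"
        by (cases b) auto
      with bu w(1) show False
        by (auto simp: N_def V_def)
    qed
    then show "weight y p d (Suc m # w) = y * weight y p d w"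
      by (rule weight_Cons)
  qed simp
  have "N \<union> (\<Union>i<m. V i) = UNIV"
    by (auto simp: N_def)
  then have "DSV y p d = gf y p d (N \<union> (\<Union>i<m. V i))"
    by (simp only: DSV_eq_gf)
  also have "\<dots> = gf y p d N + (\<Sum>i<m. gf y p d (V i))"
    using disj by (subst gf_Un) (auto simp: N_def gf_UN)
  finally have N: "gf y p d N = DSV y p d - (\<Sum>i<m. gf y p d (V i))"
    by simp
  have "F = gf y p d (Cons (Suc m) ` N \<union> (\<Union>i<m. Cons (Suc m) ` V i))"
    unfolding F_def N_def by (intro arg_cong[where f = "gf y p d"]) auto
  also have "\<dots> = gf y p d (Cons (Suc m) ` N) + (\<Sum>i<m. gf y p d (Cons (Suc m) ` V i))"
    using disj by (subst gf_Un, force simp: N_def, subst gf_UN)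
      (auto simp: disjoint_family_on_def)
  also have "\<dots> = fps_X ^ Suc m * fps_const y * DSV y p d
      + (\<Sum>i<m. fps_X ^ Suc m * fps_const y * fps_const (p * d ^ (m - i) - 1) * gf y p d (V i))"
    by (simp add: gf_Cons_N gf_Cons_V N algebra_simps sum_distrib_left sum_subtractf
        flip: fps_const_mult fps_const_sub)
  also have "(\<Sum>i<m. fps_X ^ Suc m * fps_const y * fps_const (p * d ^ (m - i) - 1) * gf y p d (V i))
      = fps_X ^ Suc m * fps_const y * (fps_const y * fps_X * T m * F)"
    unfolding T_def
    unfolding sum_distrib_left sum_distrib_right
    by (intro sum.cong refl) (simp add: gf_V mult_ac del: fps_const_mult)
  finally show ?thesis
    by (simp only: F_def distrib_left)
qed

text \<open>
  Splitting by the first part: the first part of a composition of \<open>n\<close> is at most \<open>n\<close>, so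
  finitely many first parts account for each coefficient.
\<close>

lemma DSV_nth_eq_sum_gf_first:
  assumes "n \<le> m"
  shows "fps_nth (DSV y p d) n = fps_nth (1 + (\<Sum>i<m. gf_first y p d (Suc i))) n"
proof -
  have "gf y p d (insert [] (\<Union>i<m. range (Cons (Suc i)))) = gf y p d {[]}
      + (\<Sum>i<m. gf_first y p d (Suc i))"
    by (subst insert_is_Un, subst gf_Un, force, subst gf_UN) (auto simp: disjoint_family_on_def)
  moreover have "gf y p d {[]} = 1"
  proof (rule fps_ext)
    fix k :: nat
    have "{w. w = [] \<and> sum_list w = k \<and> 0 \<notin> set w} = (if k = 0 then {[]} else {})"
      by auto
    then show "fps_nth (gf y p d {[]}) k = fps_nth 1 k"
      by (simp add: gf_def weight_def sv_def dsv_def sym_valleys_def)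
  qed
  moreover have "fps_nth (gf y p d UNIV) n
      = fps_nth (gf y p d (insert [] (\<Union>i<m. range (Cons (Suc i))))) n"
  proof -
    have "w \<in> insert [] (\<Union>i<m. range (Cons (Suc i)))" if "sum_list w = n" "0 \<notin> set w" for w
    proof (cases w)
      case (Cons a u)
      with that obtain i where "a = Suc i"
        by (cases a) auto
      with Cons that assms have "w \<in> range (Cons (Suc i))" "i < m"
        by auto
      then show ?thesis
        by blast
    qed simp
    then show ?thesis
      unfolding gf_def fps_nth_Abs_fps by (intro sum.cong) blast+
  qed
  ultimately show ?thesis
    by (simp add: DSV_eq_gf)
qed


section \<open>The closed form\<close>

text \<open>
  With \<open>a = Suc m\<close>, the two quotients in the closed form are the sums of
  \<open>p * d\<^bsup>a-b\<^esup> * x\<^bsup>b-1\<^esup>\<close> and of \<open>x\<^bsup>b-1\<^esup>\<close> over \<open>0 < b < a\<close>. Both denominators have a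
  nonzero constant term, so the quotients can be checked by multiplying out.
\<close>

lemma dsv_term_Suc:
  fixes y p d :: "'a::field"
  assumes "d \<noteq> 0"
  shows "dsv_term y p d (Suc m) = fps_X ^ Suc m * fps_const y /
    (1 - fps_const y ^ 2 * fps_X ^ (m + 2) *
       (\<Sum>i<m. fps_X ^ i * fps_const (p * d ^ (m - i) - 1)))"
proof -
  have X_d: "fps_X - fps_const d = fps_const d * (fps_X / fps_const d - 1)"
    using assms by (simp add: right_diff_distrib unit_div_mult_swap)
  have "fps_X ^ m - fps_const d ^ m
      = (fps_X - fps_const d) * (\<Sum>i<m. fps_const d ^ (m - Suc i) * fps_X ^ i)"
    by (rule power_diff_sumr2)
  also have "\<dots> = (fps_X / fps_const d - 1)
      * (\<Sum>i<m. fps_const d * fps_const d ^ (m - Suc i) * fps_X ^ i)"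
    unfolding X_d by (simp only: sum_distrib_left mult_ac)
  also have "(\<Sum>i<m. fps_const d * fps_const d ^ (m - Suc i) * fps_X ^ i)
      = (\<Sum>i<m. fps_X ^ i * fps_const (d ^ (m - i)))"
  proof (intro sum.cong refl)
    fix i assume "i \<in> {..<m}"
    then have "fps_const d * fps_const d ^ (m - Suc i) = fps_const (d ^ (m - i))"
      by (simp add: Suc_diff_Suc flip: power_Suc)
    then show "fps_const d * fps_const d ^ (m - Suc i) * fps_X ^ i
        = fps_X ^ i * fps_const (d ^ (m - i))"
      by (simp only: mult.commute)
  qed
  finally have "fps_const p * (fps_X ^ m - fps_const d ^ m) / (fps_X / fps_const d - 1)
      = fps_const p * (\<Sum>i<m. fps_X ^ i * fps_const (d ^ (m - i)))"
    using assms by (subst unit_eq_div1) (auto simp: fps_divide_unit mult_ac)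
  moreover have "(fps_X ^ m - 1) / (fps_X - 1) = (\<Sum>i<m. fps_X ^ i :: 'a fps)"
    by (subst unit_eq_div1) (simp_all add: power_diff_1_eq mult.commute)
  ultimately have "fps_const p * (fps_X ^ m - fps_const d ^ m) / (fps_X / fps_const d - 1)
       - (fps_X ^ m - 1) / (fps_X - 1)
      = (\<Sum>i<m. fps_X ^ i * fps_const (p * d ^ (m - i) - 1))"
    by (simp add: sum_distrib_left algebra_simps sum_subtractf
        flip: fps_const_mult fps_const_sub)
  then show ?thesis
    by (simp add: dsv_term_def)
qed

lemma DSV_nth_0: "fps_nth (DSV y p d) 0 = 1"
  by (simp add: DSV_nth_eq_sum_gf_first[of 0 0])

text \<open>
  This solves the linear equation of \<open>gf_first_recurrence\<close>; the coefficient \<open>K\<close> of the unknown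
  has constant term 1 and is therefore a unit.
\<close>

lemma dsv_term_mult_DSV:
  fixes y p d :: "'a::field"
  assumes "d \<noteq> 0"
  shows "dsv_term y p d (Suc m) * DSV y p d = gf_first y p d (Suc m)"
proof -
  define K where "K = 1 - fps_const y ^ 2 * fps_X ^ (m + 2) *
       (\<Sum>i<m. fps_X ^ i * fps_const (p * d ^ (m - i) - 1))"
  have "K dvd 1"
    by (simp add: K_def fps_mult_nth_0)
  moreover have "fps_X ^ Suc m * fps_const y * DSV y p d = gf_first y p d (Suc m) * K"
  proof -
    define A B where "A = fps_X ^ Suc m * fps_const y"
      and "B = fps_const y * fps_X * (\<Sum>i<m. fps_X ^ i * fps_const (p * d ^ (m - i) - 1))"
    have "A * DSV y p d = A * (DSV y p d + B * gf_first y p d (Suc m))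
        - gf_first y p d (Suc m) * (A * B)"
      by (simp add: algebra_simps)
    also have "A * (DSV y p d + B * gf_first y p d (Suc m)) = gf_first y p d (Suc m)"
      unfolding A_def B_def by (rule gf_first_recurrence[symmetric])
    also have "gf_first y p d (Suc m) - gf_first y p d (Suc m) * (A * B)
        = gf_first y p d (Suc m) * (1 - A * B)"
      by (simp add: right_diff_distrib)
    also have "1 - A * B = K"
      by (simp add: A_def B_def K_def power2_eq_square mult_ac)
    finally show ?thesis
      by (simp only: A_def)
  qed
  ultimately show ?thesis
    unfolding dsv_term_Suc[OF assms] K_def[symmetric]
    by (metis unit_div_commute unit_eq_div1)
qed

theorem DSV_closed_form:
  fixes y p d :: "'a::field"
  assumes "d \<noteq> 0"
  shows "summable (\<lambda>i. dsv_term y p d (Suc i)) \<and>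
    DSV y p d = 1 / (1 - (\<Sum>i. dsv_term y p d (Suc i)))"
proof -
  \<comment> \<open>Multiplication by a fixed series makes coefficient \<open>n\<close> depend only on coefficients up to
    \<open>n\<close>, so after dividing by \<open>?D\<close> the partial sums still stabilise coefficientwise.\<close>
  let ?D = "DSV y p d"
  have unit: "?D dvd 1"
    by (simp add: DSV_nth_0)
  have D_inv: "?D * (1 / ?D) = 1"
    using unit by simp
  have "(\<lambda>i. dsv_term y p d (Suc i)) sums (1 - 1 / ?D)"
    unfolding sums_def
  proof (rule tendsto_fpsI)
    fix n
    have "fps_nth (\<Sum>i<m. dsv_term y p d (Suc i)) n = fps_nth (1 - 1 / ?D) n" if "n \<le> m" for m
    proof -
      have "dsv_term y p d (Suc i) = gf_first y p d (Suc i) * (1 / ?D)" for i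
        using D_inv by (simp add: mult.assoc flip: dsv_term_mult_DSV[OF assms])
      then have "(\<Sum>i<m. dsv_term y p d (Suc i)) = (\<Sum>i<m. gf_first y p d (Suc i)) * (1 / ?D)"
        by (simp only: sum_distrib_right)
      also have "fps_nth \<dots> n = fps_nth ((?D - 1) * (1 / ?D)) n"
        unfolding fps_mult_nth
        using that by (intro sum.cong refl) (simp add: DSV_nth_eq_sum_gf_first[of _ m])
      also have "(?D - 1) * (1 / ?D) = 1 - 1 / ?D"
        using D_inv by (simp only: left_diff_distrib mult_1_left)
      finally show ?thesis .
    qed
    then show "\<forall>\<^sub>F m in sequentially.
        fps_nth (\<Sum>i<m. dsv_term y p d (Suc i)) n = fps_nth (1 - 1 / ?D) n"
      unfolding eventually_sequentially by blast
  qed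
  then show ?thesis
    using unit by (auto simp: sums_iff)
qed

theorem theorem5:
  shows "summable (\<lambda>i. dsv_term var_y var_p var_d (Suc i)) \<and>
    DSV var_y var_p var_d = 1 / (1 - (\<Sum>i. dsv_term var_y var_p var_d (Suc i)))"
proof (rule DSV_closed_form)
  show "var_d \<noteq> 0"
    by (simp add: var_d_def)
qed

end
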